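(* Let $S$ be a uniserial semiring. Then $S$ is classical if and only if $\operatorname{Ann}(\operatorname{Ann}(b))=(b)$ for all $b\in S$.
   Context: A semiring is an algebraic structure $(S,+,\cdot,0,1)$ such that $(S,+,0)$ and $(S,\cdot,1)$ are commutative monoids, multiplication distributes over addition, and $s\cdot 0=0$ for all $s\in S$. A nonempty subset $I\subseteq S$ is an ideal if $a+b\in I$ and $sa\in I$ for all $a,b\in I$ and $s\in S$. A semiring is uniserial if its ideals are linearly ordered by inclusion. For $b\in S$, $(b)$ denotes the principal ideal generated by $b$. For a nonempty subset $B\subseteq S$, $\operatorname{Ann}(B)=\{s\in S: sb=0 \text{ for all } b\in B\}$, and $\operatorname{Ann}(b)=\operatorname{Ann}(\{b\})$. An element $s\in S$ is a unit if $st=1$ for some $t\in S$; it is a zero-divisor if $sx=0$ for some nonzero $x\in S$. A semiring is classical if each of its elements is either a unit or a zero-divisor. *)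

theory Defs
  imports "HOL-Algebra.Ring"
begin

text \<open>
  Semirings are commutative and have both neutral elements. As in \<^locale>\<open>semiring\<close>,
  \<open>\<zero> \<noteq> \<one>\<close> is not required, so the one-element semiring is included.
\<close>

locale commutative_semiring = semiring S + comm_monoid S for S (structure)

text \<open>
  The library predicate \<open>ideal\<close> requires a ring (ideals are there additive subgroups), hence
  these definitions. Absorption on one side suffices, since multiplication is commutative.
\<close>

definition semiring_ideal :: "('a, 'm) ring_scheme \<Rightarrow> 'a set \<Rightarrow> bool" where
  "semiring_ideal S I \<longleftrightarrow>
     I \<subseteq> carrier S \<and> I \<noteq> {} \<and>
     (\<forall>a\<in>I. \<forall>b\<in>I. a \<oplus>\<^bsub>S\<^esub> b \<in> I) \<and>
     (\<forall>s\<in>carrier S. \<forall>a\<in>I. s \<otimes>\<^bsub>S\<^esub> a \<in> I)"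

definition principal_ideal :: "('a, 'm) ring_scheme \<Rightarrow> 'a \<Rightarrow> 'a set" where
  "principal_ideal S b = \<Inter>{I. semiring_ideal S I \<and> b \<in> I}"

definition uniserial :: "('a, 'm) ring_scheme \<Rightarrow> bool" where
  "uniserial S \<longleftrightarrow>
     (\<forall>I J. semiring_ideal S I \<longrightarrow> semiring_ideal S J \<longrightarrow> I \<subseteq> J \<or> J \<subseteq> I)"

definition Ann :: "('a, 'm) ring_scheme \<Rightarrow> 'a set \<Rightarrow> 'a set" where
  "Ann S B = {s \<in> carrier S. \<forall>b\<in>B. s \<otimes>\<^bsub>S\<^esub> b = \<zero>\<^bsub>S\<^esub>}"

text \<open>
  \<open>\<zero>\<close> counts as a zero-divisor as soon as the semiring has a nonzero element.
\<close>

definition zero_divisor :: "('a, 'm) ring_scheme \<Rightarrow> 'a \<Rightarrow> bool" where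
  "zero_divisor S s \<longleftrightarrow>
     s \<in> carrier S \<and> (\<exists>x\<in>carrier S. x \<noteq> \<zero>\<^bsub>S\<^esub> \<and> s \<otimes>\<^bsub>S\<^esub> x = \<zero>\<^bsub>S\<^esub>)"

definition classical :: "('a, 'm) ring_scheme \<Rightarrow> bool" where
  "classical S \<longleftrightarrow> (\<forall>s\<in>carrier S. s \<in> Units S \<or> zero_divisor S s)"

end

theory Submission
  imports Defs
begin

text \<open>
  In a uniserial semiring, divisibility is a total preorder: of any two elements one is a
  multiple of the other. If every element is a unit or a zero-divisor and \<open>c\<close> annihilates
  \<open>Ann b\<close> without being a multiple of \<open>b\<close>, then \<open>b = s c\<close>, where \<open>s\<close> cannot be a unit, so
  \<open>s x = 0\<close> for some \<open>x \<noteq> 0\<close>. Now compare \<open>x\<close> with \<open>c\<close>. If \<open>x = t c\<close>, then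
  \<open>t b = s x = 0\<close>, so \<open>t \<in> Ann b\<close> and hence \<open>x = t c = 0\<close>, which is absurd. If \<open>c = t x\<close>,
  then \<open>b = s t x = 0\<close>, so \<open>1\<close> annihilates \<open>b\<close> and \<open>c = 1 c = 0 = b\<close>, absurd again.

  Conversely, an element \<open>s\<close> that is not a zero-divisor has annihilator \<open>{0}\<close>, whose
  annihilator is everything. If this is \<open>(s)\<close>, then \<open>1\<close> is a multiple of \<open>s\<close>,
  so \<open>s\<close> is a unit.
\<close>

context commutative_semiring
begin

text \<open>
  \<open>principal_ideal\<close> is an intersection of ideals; the next two lemmas give access
  to its elements as multiples of the generator.
\<close>

lemma semiring_ideal_multiples:
  assumes "b \<in> carrier S"
  shows "semiring_ideal S {s \<otimes> b | s. s \<in> carrier S}"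
proof -
  have "\<exists>r. s \<otimes> b \<oplus> t \<otimes> b = r \<otimes> b \<and> r \<in> carrier S"
    if "s \<in> carrier S" "t \<in> carrier S" for s t
    using that assms l_distr[of s t b] by (metis add.m_closed)
  moreover have "\<exists>r. s \<otimes> (t \<otimes> b) = r \<otimes> b \<and> r \<in> carrier S"
    if "s \<in> carrier S" "t \<in> carrier S" for s t
    using that assms m_assoc[of s t b] by (metis m_closed)
  ultimately show ?thesis
    using assms unfolding semiring_ideal_def by auto
qed

lemma principal_ideal_eq_multiples:
  assumes "b \<in> carrier S"
  shows "principal_ideal S b = {s \<otimes> b | s. s \<in> carrier S}"
proof
  have "b \<in> {s \<otimes> b | s. s \<in> carrier S}"
    using assms by (metis (mono_tags, lifting) l_one mem_Collect_eq one_closed)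
  then show "principal_ideal S b \<subseteq> {s \<otimes> b | s. s \<in> carrier S}"
    using semiring_ideal_multiples[OF assms] unfolding principal_ideal_def by blast
  show "{s \<otimes> b | s. s \<in> carrier S} \<subseteq> principal_ideal S b"
    unfolding principal_ideal_def semiring_ideal_def by auto
qed

lemma mem_principal_ideal_iff:
  assumes "b \<in> carrier S"
  shows "c \<in> principal_ideal S b \<longleftrightarrow> (\<exists>s\<in>carrier S. c = s \<otimes> b)"
  using principal_ideal_eq_multiples[OF assms] by auto

text \<open>
  Uniseriality enters the proof only in this form, by comparing the ideals \<open>(a)\<close> and \<open>(b)\<close>.
\<close>

lemma uniserial_multiple_cases:
  assumes "uniserial S" and "a \<in> carrier S" "b \<in> carrier S"
  obtains (left) s where "s \<in> carrier S" "a = s \<otimes> b"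
    | (right) s where "s \<in> carrier S" "b = s \<otimes> a"
proof -
  have "semiring_ideal S (principal_ideal S a)" "semiring_ideal S (principal_ideal S b)"
    using assms semiring_ideal_multiples principal_ideal_eq_multiples by auto
  then have "principal_ideal S a \<subseteq> principal_ideal S b \<or> principal_ideal S b \<subseteq> principal_ideal S a"
    using assms(1) unfolding uniserial_def by blast
  moreover have "a \<in> principal_ideal S a" "b \<in> principal_ideal S b"
    unfolding principal_ideal_def by auto
  ultimately show thesis
    using assms mem_principal_ideal_iff left right by blast
qed

lemma principal_ideal_subset_Ann_Ann:
  assumes "b \<in> carrier S"
  shows "principal_ideal S b \<subseteq> Ann S (Ann S {b})"
proof
  fix c
  assume "c \<in> principal_ideal S b"
  then obtain s where s: "s \<in> carrier S" "c = s \<otimes> b"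
    using mem_principal_ideal_iff[OF assms] by blast
  have "c \<otimes> t = \<zero>" if t: "t \<in> carrier S" "t \<otimes> b = \<zero>" for t
  proof -
    have "c \<otimes> t = s \<otimes> (t \<otimes> b)"
      using s t(1) assms m_lcomm[of t s b] by (simp add: m_comm)
    then show ?thesis
      using s t by simp
  qed
  then show "c \<in> Ann S (Ann S {b})"
    using s assms unfolding Ann_def by auto
qed

text \<open>
  If \<open>b = s c\<close> with \<open>s\<close> a unit, then \<open>c\<close> is a multiple of \<open>b\<close>. If instead \<open>s x = 0\<close> with
  \<open>x \<noteq> 0\<close>, the witness that settles the case comes from comparing \<open>x\<close> with \<open>c\<close>: a factor
  \<open>t\<close> with \<open>x = t c\<close> would lie in \<open>Ann b\<close> and not annihilate \<open>c\<close>, so \<open>c\<close> is a multiple of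
  \<open>x\<close>, which forces \<open>b = c = 0\<close>.
\<close>

lemma classical_Ann_Ann_subset_principal_ideal:
  assumes "uniserial S" "classical S" and b: "b \<in> carrier S"
  shows "Ann S (Ann S {b}) \<subseteq> principal_ideal S b"
proof
  fix c
  assume "c \<in> Ann S (Ann S {b})"
  then have c: "c \<in> carrier S"
    and c_ann: "\<And>t. t \<in> carrier S \<Longrightarrow> t \<otimes> b = \<zero> \<Longrightarrow> t \<otimes> c = \<zero>"
    unfolding Ann_def by (auto simp: m_comm)
  show "c \<in> principal_ideal S b"
    using assms(1) c b
  proof (cases rule: uniserial_multiple_cases)
    case left
    then show ?thesis
      using mem_principal_ideal_iff[OF b] by blast
  next
    case (right s)
    from \<open>classical S\<close> right consider "s \<in> Units S" | "zero_divisor S s"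
      unfolding classical_def by blast
    then show ?thesis
    proof cases
      case 1
      then have "inv s \<otimes> b = c"
        using right c by (simp add: m_assoc[symmetric])
      then show ?thesis
        using 1 mem_principal_ideal_iff[OF b] Units_inv_closed by metis
    next
      case 2
      then obtain x where x: "x \<in> carrier S" "x \<noteq> \<zero>" "s \<otimes> x = \<zero>"
        unfolding zero_divisor_def by blast
      show ?thesis
        using assms(1) x(1) c
      proof (cases rule: uniserial_multiple_cases)
        case (left t)
        have "t \<otimes> b = s \<otimes> x"
          using left right c by (simp add: m_lcomm)
        then have "t \<otimes> c = \<zero>"
          using c_ann left x by simp
        then show ?thesis
          using left x by simp
      next
        case t: (right t)
        have "b = t \<otimes> (s \<otimes> x)"
          using t right x m_lcomm[of s t x] by simp
        then have "b = \<zero>"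
          using t x by simp
        \<comment> \<open>The annihilator of \<open>0\<close> contains \<open>1\<close>, and \<open>c\<close> annihilates it.\<close>
        then have "c = \<zero>"
          using c_ann[of \<one>] c by simp
        then show ?thesis
          using \<open>b = \<zero>\<close> mem_principal_ideal_iff[OF b] by force
      qed
    qed
  qed
qed

text \<open>
  An element with trivial annihilator has the whole semiring as double annihilator, so the
  assumed equality puts \<open>1\<close> into the ideal that it generates.
\<close>

lemma Units_if_not_zero_divisor:
  assumes "s \<in> carrier S" "\<not> zero_divisor S s"
    and "Ann S (Ann S {s}) = principal_ideal S s"
  shows "s \<in> Units S"
proof -
  have "Ann S {s} \<subseteq> {\<zero>}"
    using assms(1,2) m_comm unfolding Ann_def zero_divisor_def by auto
  then have "\<one> \<in> Ann S (Ann S {s})"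
    unfolding Ann_def by auto
  then obtain t where "t \<in> carrier S" "\<one> = t \<otimes> s"
    using assms mem_principal_ideal_iff by auto
  then show ?thesis
    using assms(1) m_comm unfolding Units_def by force
qed

end

theorem theorem3p15:
  fixes S :: "('a, 'm) ring_scheme" (structure)
  assumes "commutative_semiring S"
    and "uniserial S"
  shows "classical S \<longleftrightarrow>
    (\<forall>b\<in>carrier S. Ann S (Ann S {b}) = principal_ideal S b)"
proof -
  interpret commutative_semiring S by fact
  show ?thesis
  proof
    assume "classical S"
    then show "\<forall>b\<in>carrier S. Ann S (Ann S {b}) = principal_ideal S b"
      using assms(2) classical_Ann_Ann_subset_principal_ideal principal_ideal_subset_Ann_Ann
      by blast
  next
    assume "\<forall>b\<in>carrier S. Ann S (Ann S {b}) = principal_ideal S b"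
    then show "classical S"
      using Units_if_not_zero_divisor unfolding classical_def by blast
  qed
qed

end
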